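(* Let $H$ be a real separable Hilbert space, let $R:H\to H$ be a bounded linear self-adjoint operator, and let $\alpha\in(0,1)$. Up to an equivalent renorming, it holds $$\mathrm{BUC}_R^\alpha(H)=(\mathrm{BUC}(H),\mathrm{Lip}_{b,R}(H))_{\alpha,\infty}.$$
   Context: $\mathrm{BUC}(H)$ is the Banach space of bounded uniformly continuous functions $f:H\to\mathbb{R}$ with the sup norm $\|\cdot\|_\infty$. $\mathrm{BUC}^\alpha_R(H)$ is the space of $f\in\mathrm{BUC}(H)$ with $[f]_{R,\alpha}:=\sup_{x,v\in H,\,v\neq0}\frac{|f(x+Rv)-f(x)|}{\|v\|_H^\alpha}<+\infty$, normed by $\|f\|_\infty+[f]_{R,\alpha}$. $\mathrm{Lip}_{b,R}(H)$ is the space of $f\in\mathrm{BUC}(H)$ with $[f]_R:=\sup_{x,v\in H,\,v\neq0}\frac{|f(x+Rv)-f(x)|}{\|v\|_H}<+\infty$, normed by $\|f\|_\infty+[f]_R$. Real interpolation ($K$-method): for Banach spaces $K_2\subseteq K_1$ with continuous embedding, $r>0$ and $x\in K_1$, let $K(r,x):=\inf\{\|a\|_{K_1}+r\|b\|_{K_2} : x=a+b,\ a\in K_1,\ b\in K_2\}$; for $\vartheta\in(0,1)$, $\|x\|_{(K_1,K_2)_{\vartheta,\infty}}:=\sup_{r>0}r^{-\vartheta}K(r,x)$ and $(K_1,K_2)_{\vartheta,\infty}:=\{x\in K_1:\|x\|_{(K_1,K_2)_{\vartheta,\infty}}<+\infty\}$. *)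

theory Defs
  imports "HOL-Analysis.Analysis"
begin

(* The function spaces are subsets of the type of bounded continuous functions,
   whose library norm is the sup norm. *)
definition BUC :: "('h::metric_space \<Rightarrow>\<^sub>C real) set" where
  "BUC = {f. uniformly_continuous_on UNIV (apply_bcontfun f)}"

(* Seminorms are suprema in [0, \<infinity>]: "sup < +\<infinity>" is then meaningful as it stands,
   and the supremum over the empty index set (for H = {0}) is 0. *)
definition hoelder_seminorm ::
    "('h::real_normed_vector \<Rightarrow> 'h) \<Rightarrow> real \<Rightarrow> ('h \<Rightarrow>\<^sub>C real) \<Rightarrow> ennreal" where
  "hoelder_seminorm R \<alpha> f =
     (SUP (x, v) \<in> UNIV \<times> (UNIV - {0}). ennreal (\<bar>f (x + R v) - f x\<bar> / norm v powr \<alpha>))"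

definition BUC_hoelder :: "('h::real_normed_vector \<Rightarrow> 'h) \<Rightarrow> real \<Rightarrow> ('h \<Rightarrow>\<^sub>C real) set" where
  "BUC_hoelder R \<alpha> = {f \<in> BUC. hoelder_seminorm R \<alpha> f < \<infinity>}"

definition hoelder_norm ::
    "('h::real_normed_vector \<Rightarrow> 'h) \<Rightarrow> real \<Rightarrow> ('h \<Rightarrow>\<^sub>C real) \<Rightarrow> real" where
  "hoelder_norm R \<alpha> f = norm f + enn2real (hoelder_seminorm R \<alpha> f)"

definition lip_seminorm ::
    "('h::real_normed_vector \<Rightarrow> 'h) \<Rightarrow> ('h \<Rightarrow>\<^sub>C real) \<Rightarrow> ennreal" where
  "lip_seminorm R f =
     (SUP (x, v) \<in> UNIV \<times> (UNIV - {0}). ennreal (\<bar>f (x + R v) - f x\<bar> / norm v))"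

definition Lip_b :: "('h::real_normed_vector \<Rightarrow> 'h) \<Rightarrow> ('h \<Rightarrow>\<^sub>C real) set" where
  "Lip_b R = {f \<in> BUC. lip_seminorm R f < \<infinity>}"

definition lip_norm ::
    "('h::real_normed_vector \<Rightarrow> 'h) \<Rightarrow> ('h \<Rightarrow>\<^sub>C real) \<Rightarrow> real" where
  "lip_norm R f = norm f + enn2real (lip_seminorm R f)"

(* K-method for a couple of Banach spaces, each given by its carrier and its norm
   inside a common vector space: (K1, n1) and (K2, n2) with K2 continuously
   embedded in K1. *)
definition K_functional ::
    "'v::real_vector set \<Rightarrow> ('v \<Rightarrow> real) \<Rightarrow> 'v set \<Rightarrow> ('v \<Rightarrow> real) \<Rightarrow> real \<Rightarrow> 'v \<Rightarrow> real" where
  "K_functional K1 n1 K2 n2 r x = Inf {n1 a + r * n2 b | a b. x = a + b \<and> a \<in> K1 \<and> b \<in> K2}"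

definition interp_enorm ::
    "'v::real_vector set \<Rightarrow> ('v \<Rightarrow> real) \<Rightarrow> 'v set \<Rightarrow> ('v \<Rightarrow> real) \<Rightarrow> real \<Rightarrow> 'v \<Rightarrow> ennreal" where
  "interp_enorm K1 n1 K2 n2 \<theta> x =
     (SUP r \<in> {0<..}. ennreal (r powr (- \<theta>) * K_functional K1 n1 K2 n2 r x))"

definition interp_space ::
    "'v::real_vector set \<Rightarrow> ('v \<Rightarrow> real) \<Rightarrow> 'v set \<Rightarrow> ('v \<Rightarrow> real) \<Rightarrow> real \<Rightarrow> 'v set" where
  "interp_space K1 n1 K2 n2 \<theta> = {x \<in> K1. interp_enorm K1 n1 K2 n2 \<theta> x < \<infinity>}"

definition interp_norm ::
    "'v::real_vector set \<Rightarrow> ('v \<Rightarrow> real) \<Rightarrow> 'v set \<Rightarrow> ('v \<Rightarrow> real) \<Rightarrow> real \<Rightarrow> 'v \<Rightarrow> real" where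
  "interp_norm K1 n1 K2 n2 \<theta> x = enn2real (interp_enorm K1 n1 K2 n2 \<theta> x)"

definition equivalent_norms_on :: "'v set \<Rightarrow> ('v \<Rightarrow> real) \<Rightarrow> ('v \<Rightarrow> real) \<Rightarrow> bool" where
  "equivalent_norms_on X n1 n2 \<longleftrightarrow>
     (\<exists>c>0. \<exists>C>0. \<forall>x\<in>X. c * n1 x \<le> n2 x \<and> n2 x \<le> C * n1 x)"

end

theory Submission
  imports Defs
begin

text \<open>
  Both inequalities between the norms come from the splittings \<open>f = a + b\<close> that define the
  \<open>K\<close>-functional.

  If \<open>f\<close> lies in the interpolation space, every splitting bounds its increments along \<open>R v\<close>: that of
  \<open>a\<close> is at most \<open>2 * norm a\<close>, and that of \<open>b\<close> at most \<open>r = norm v\<close> times its Lipschitz seminorm.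
  The infimum over all splittings bounds the increment of \<open>f\<close> by twice the \<open>K\<close>-functional at
  \<open>r\<close>, hence by a multiple of \<open>r powr \<alpha>\<close>.  The scale \<open>r = 1\<close> controls the sup norm.

  If \<open>f\<close> is Hoelder along \<open>R\<close> with seminorm \<open>M\<close>, a good splitting at scale \<open>r\<close> is given by the
  infimal convolution of \<open>f\<close> with a cone along the range of \<open>R\<close>,
  \<open>b x = (INF v. f (x + R v) + L * norm v)\<close>, of slope \<open>L = M * r powr (\<alpha> - 1)\<close>.
  Substituting \<open>v + w\<close> for \<open>v\<close> shows that \<open>b\<close> is \<open>L\<close>-Lipschitz along \<open>R\<close>, and the choice of \<open>L\<close>
  makes \<open>f - b\<close> at most \<open>M * r powr \<alpha>\<close> (lemma \<open>hoelder_splitting\<close>).  Since \<open>b\<close> inherits both the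
  bound and the modulus of continuity of \<open>f\<close>, the splitting stays inside the uniformly continuous
  functions.  It is used for \<open>r \<le> 1\<close>; for \<open>r \<ge> 1\<close> the trivial splitting \<open>f = f + 0\<close> is good enough.
\<close>

section \<open>Seminorms along an operator\<close>

text \<open>This lets facts on the Hoelder seminorm with arbitrary exponent cover the Lipschitz one too.\<close>

lemma lip_seminorm_eq_hoelder_seminorm: "lip_seminorm R f = hoelder_seminorm R 1 f"
  unfolding lip_seminorm_def hoelder_seminorm_def
  by (intro SUP_cong) auto

lemma hoelder_seminorm_leI:
  fixes f :: "'a::real_normed_vector \<Rightarrow>\<^sub>C real"
  assumes "\<And>x v. v \<noteq> 0 \<Longrightarrow> \<bar>apply_bcontfun f (x + R v) - f x\<bar> \<le> C * norm v powr \<beta>"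
  shows "hoelder_seminorm R \<beta> f \<le> ennreal C"
  unfolding hoelder_seminorm_def
proof (rule SUP_least)
  fix p :: "'a \<times> 'a"
  assume "p \<in> UNIV \<times> (UNIV - {0})"
  then obtain x v where p: "p = (x, v)" "v \<noteq> 0" by auto
  then have "\<bar>f (x + R v) - f x\<bar> / norm v powr \<beta> \<le> C"
    using assms[of v x] by (simp add: divide_le_eq)
  then show "(case p of (x, v) \<Rightarrow> ennreal (\<bar>f (x + R v) - f x\<bar> / norm v powr \<beta>)) \<le> ennreal C"
    using p by (simp add: ennreal_leI)
qed

lemma hoelder_seminorm_increment_le:
  assumes "hoelder_seminorm R \<beta> f < \<infinity>" and "linear R"
  shows "\<bar>apply_bcontfun f (x + R v) - f x\<bar> \<le> enn2real (hoelder_seminorm R \<beta> f) * norm v powr \<beta>"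
proof (cases "v = 0")
  case True
  then show ?thesis using linear_0[OF assms(2)] by simp
next
  case False
  have "ennreal (\<bar>f (x + R v) - f x\<bar> / norm v powr \<beta>) \<le> hoelder_seminorm R \<beta> f"
    unfolding hoelder_seminorm_def
    by (rule SUP_upper2[of "(x, v)"]) (use False in auto)
  then have "ennreal (\<bar>f (x + R v) - f x\<bar> / norm v powr \<beta>)
      \<le> ennreal (enn2real (hoelder_seminorm R \<beta> f))"
    using assms(1) by simp
  then show ?thesis
    using False by (simp add: divide_le_eq)
qed

section \<open>Infimal convolution with a cone\<close>

definition inf_conv_cone ::
    "('h::real_normed_vector \<Rightarrow> 'h) \<Rightarrow> real \<Rightarrow> ('h \<Rightarrow>\<^sub>C real) \<Rightarrow> 'h \<Rightarrow> real" where
  "inf_conv_cone R L f x = (INF v. f (x + R v) + L * norm v)"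

lemma bcontfun_ge_minus_norm: "- norm f \<le> apply_bcontfun f x"
  for f :: "'h::topological_space \<Rightarrow>\<^sub>C real"
  using norm_bounded[of f x] by simp

lemma inf_conv_cone_le:
  assumes "0 \<le> L"
  shows "inf_conv_cone R L f x \<le> f (x + R v) + L * norm v"
  unfolding inf_conv_cone_def
proof (rule cINF_lower)
  show "bdd_below (range (\<lambda>v. f (x + R v) + L * norm v))"
    using assms bcontfun_ge_minus_norm[of f]
    by (intro bdd_belowI2[where m = "- norm f"] add_increasing2) auto
qed simp

lemma inf_conv_cone_ge:
  assumes "\<And>v. c \<le> apply_bcontfun f (x + R v) + L * norm v"
  shows "c \<le> inf_conv_cone R L f x"
  unfolding inf_conv_cone_def by (rule cINF_greatest) (use assms in auto)

lemma inf_conv_cone_le_self: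
  assumes "0 \<le> L" and "linear R"
  shows "inf_conv_cone R L f x \<le> f x"
  using inf_conv_cone_le[OF assms(1), of R f x 0] linear_0[OF assms(2)] by simp

lemma abs_inf_conv_cone_le_norm:
  assumes "0 \<le> L" and "linear R"
  shows "\<bar>inf_conv_cone R L f x\<bar> \<le> norm f"
proof -
  have "- norm f \<le> inf_conv_cone R L f x"
    using assms(1) bcontfun_ge_minus_norm[of f]
    by (intro inf_conv_cone_ge add_increasing2) auto
  moreover have "f x \<le> norm f"
    using norm_bounded[of f x] by simp
  ultimately show ?thesis
    using inf_conv_cone_le_self[OF assms, of f x] by simp
qed

text \<open>The translates \<open>x + R v\<close> and \<open>y + R v\<close> are as far apart as \<open>x\<close> and \<open>y\<close>, so every modulus of
  continuity of the function is one of its infimal convolution.\<close>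

lemma uniformly_continuous_inf_conv_cone:
  assumes "0 \<le> L" and "f \<in> BUC"
  shows "uniformly_continuous_on UNIV (inf_conv_cone R L f)"
  unfolding uniformly_continuous_on_def
proof (intro allI impI)
  fix e :: real
  assume "0 < e"
  then obtain d where "0 < d"
    and d: "\<And>x y. dist x y < d \<Longrightarrow> \<bar>f x - f y\<bar> < e / 2"
    using assms(2) half_gt_zero[OF \<open>0 < e\<close>]
    unfolding BUC_def uniformly_continuous_on_def dist_real_def by blast
  have shift: "inf_conv_cone R L f x - e / 2 \<le> inf_conv_cone R L f y" if "dist x y < d" for x y
  proof (rule inf_conv_cone_ge)
    fix v
    have "\<bar>f (x + R v) - f (y + R v)\<bar> < e / 2"
      using that by (intro d) simp
    then show "inf_conv_cone R L f x - e / 2 \<le> f (y + R v) + L * norm v"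
      using inf_conv_cone_le[OF assms(1), of R f x v] by linarith
  qed
  have "dist (inf_conv_cone R L f y) (inf_conv_cone R L f x) < e" if "dist y x < d" for x y
    using shift[of x y] shift[of y x] that \<open>0 < e\<close>
    by (simp add: dist_real_def dist_commute abs_less_iff)
  then show "\<exists>d>0. \<forall>x\<in>UNIV. \<forall>y\<in>UNIV. dist y x < d \<longrightarrow>
      dist (inf_conv_cone R L f y) (inf_conv_cone R L f x) < e"
    using \<open>0 < d\<close> by blast
qed

lemma inf_conv_cone_lipschitz:
  assumes "0 \<le> L" and "linear R"
  shows "\<bar>inf_conv_cone R L f (x + R w) - inf_conv_cone R L f x\<bar> \<le> L * norm w"
proof -
  have shift: "inf_conv_cone R L f y - L * norm u \<le> inf_conv_cone R L f (y + R u)" for y u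
  proof (rule inf_conv_cone_ge)
    fix v
    have "inf_conv_cone R L f y \<le> f (y + R (u + v)) + L * norm (u + v)"
      by (rule inf_conv_cone_le[OF assms(1)])
    also have "\<dots> \<le> f (y + R u + R v) + L * (norm u + norm v)"
      using mult_left_mono[OF norm_triangle_ineq assms(1), of u v]
      by (simp add: linear_add[OF assms(2)] add.assoc)
    finally show "inf_conv_cone R L f y - L * norm u \<le> f (y + R u + R v) + L * norm v"
      by (simp add: algebra_simps)
  qed
  have "inf_conv_cone R L f (x + R w) - L * norm w \<le> inf_conv_cone R L f x"
    using shift[of "x + R w" "- w"] by (simp add: linear_neg[OF assms(2)])
  then show ?thesis
    using shift[of x w] by linarith
qed

text \<open>After the scaling \<open>s = r * u\<close> this is \<open>u powr \<alpha> \<le> 1 + u\<close>, which holds because \<open>u powr \<alpha>\<close> is at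
  most \<open>1\<close> for \<open>u \<le> 1\<close> and at most \<open>u\<close> for \<open>u \<ge> 1\<close>.\<close>

lemma powr_le_line:
  fixes r s \<alpha> :: real
  assumes "0 < r" "0 \<le> s" "0 < \<alpha>" "\<alpha> < 1"
  shows "s powr \<alpha> \<le> r powr \<alpha> + r powr (\<alpha> - 1) * s"
proof (cases "s \<le> r")
  case True
  then have "s powr \<alpha> \<le> r powr \<alpha>"
    using assms by (intro powr_mono2) auto
  then show ?thesis
    using assms by (simp add: add_increasing2)
next
  case False
  then have "s powr (\<alpha> - 1) \<le> r powr (\<alpha> - 1)"
    using assms by (intro powr_mono2') auto
  then have "s powr (\<alpha> - 1) * s \<le> r powr (\<alpha> - 1) * s"
    using assms by (intro mult_right_mono) auto
  moreover have "s powr (\<alpha> - 1) * s = s powr \<alpha>"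
    using False assms by (simp add: powr_diff)
  ultimately show ?thesis
    by (simp add: add_increasing)
qed

text \<open>The slope of the cone balances the two demands on the splitting: a steeper cone gives a better
  approximation but a larger Lipschitz constant, and the slope \<open>M * r powr (\<alpha> - 1)\<close> makes the error
  \<open>r\<close> times the slope.\<close>

lemma hoelder_splitting:
  fixes R :: "'h::real_normed_vector \<Rightarrow> 'h"
  assumes "linear R" "0 < \<alpha>" "\<alpha> < 1" "f \<in> BUC_hoelder R \<alpha>" "0 < r"
  defines "M \<equiv> enn2real (hoelder_seminorm R \<alpha> f)"
  obtains b where "b \<in> Lip_b R" "norm (f - b) \<le> M * r powr \<alpha>" "norm b \<le> norm f"
    "enn2real (lip_seminorm R b) \<le> M * r powr (\<alpha> - 1)"
proof -
  define L where "L = M * r powr (\<alpha> - 1)"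
  have "0 \<le> M" and "0 \<le> L"
    by (auto simp: M_def L_def)
  have f: "f \<in> BUC" "hoelder_seminorm R \<alpha> f < \<infinity>"
    using assms(4) by (auto simp: BUC_hoelder_def)
  define b where "b = Bcontfun (inf_conv_cone R L f)"
  have uc: "uniformly_continuous_on UNIV (inf_conv_cone R L f)"
    by (rule uniformly_continuous_inf_conv_cone[OF \<open>0 \<le> L\<close> f(1)])
  then have "inf_conv_cone R L f \<in> bcontfun"
    using abs_inf_conv_cone_le_norm[OF \<open>0 \<le> L\<close> assms(1), of f]
    by (intro bcontfun_normI[where b = "norm f"]) (auto intro: uniformly_continuous_imp_continuous)
  then have b: "apply_bcontfun b = inf_conv_cone R L f"
    by (simp add: b_def Bcontfun_inverse)
  have lip: "lip_seminorm R b \<le> ennreal L"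
    unfolding lip_seminorm_eq_hoelder_seminorm
    by (rule hoelder_seminorm_leI)
      (use inf_conv_cone_lipschitz[OF \<open>0 \<le> L\<close> assms(1), of f] in \<open>auto simp: b\<close>)
  show thesis
  proof (rule that)
    show "b \<in> Lip_b R"
      using uc lip by (auto simp: Lip_b_def BUC_def b intro: le_less_trans)
    show "norm b \<le> norm f"
      using abs_inf_conv_cone_le_norm[OF \<open>0 \<le> L\<close> assms(1), of f]
      by (intro norm_bound) (simp add: b)
    show "enn2real (lip_seminorm R b) \<le> M * r powr (\<alpha> - 1)"
      using enn2real_leI[OF \<open>0 \<le> L\<close> lip] by (simp add: L_def)
    show "norm (f - b) \<le> M * r powr \<alpha>"
    proof (rule norm_bound)
      fix x
      have "f x - M * r powr \<alpha> \<le> inf_conv_cone R L f x"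
      proof (rule inf_conv_cone_ge)
        fix v
        have "f x - f (x + R v) \<le> M * norm v powr \<alpha>"
          using hoelder_seminorm_increment_le[OF f(2) assms(1), of x v] by (simp add: M_def)
        also have "\<dots> \<le> M * (r powr \<alpha> + r powr (\<alpha> - 1) * norm v)"
          using \<open>0 \<le> M\<close> assms by (intro mult_left_mono powr_le_line) auto
        finally show "f x - M * r powr \<alpha> \<le> f (x + R v) + L * norm v"
          by (simp add: L_def algebra_simps)
      qed
      then show "norm (apply_bcontfun (f - b) x) \<le> M * r powr \<alpha>"
        using inf_conv_cone_le_self[OF \<open>0 \<le> L\<close> assms(1), of f x] by (simp add: b)
    qed
  qed
qed

section \<open>The K-functional\<close>

lemma K_functional_le:
  assumes "x = a + b" "a \<in> K1" "b \<in> K2" "0 \<le> r" "\<And>a. 0 \<le> n1 a" "\<And>b. 0 \<le> n2 b"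
  shows "K_functional K1 n1 K2 n2 r x \<le> n1 a + r * n2 b"
  unfolding K_functional_def
proof (rule cInf_lower)
  show "bdd_below {n1 a + r * n2 b |a b. x = a + b \<and> a \<in> K1 \<and> b \<in> K2}"
    using assms(4-6) by (intro bdd_belowI[of _ 0]) auto
qed (use assms in blast)

text \<open>Some splitting must exist, as the infimum of the empty set of reals is unspecified;
  \<open>x = x + 0\<close> serves.\<close>

lemma le_K_functionalI:
  assumes "x \<in> K1" "0 \<in> K2"
    and "\<And>a b. x = a + b \<Longrightarrow> a \<in> K1 \<Longrightarrow> b \<in> K2 \<Longrightarrow> c \<le> n1 a + r * n2 b"
  shows "c \<le> K_functional K1 n1 K2 n2 r x"
  unfolding K_functional_def
proof (rule cInf_greatest)
  have "x = x + 0" by simp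
  then show "{n1 a + r * n2 b |a b. x = a + b \<and> a \<in> K1 \<and> b \<in> K2} \<noteq> {}"
    using assms(1,2) by blast
qed (use assms(3) in blast)

lemma K_functional_le_interp_norm:
  assumes "interp_enorm K1 n1 K2 n2 \<theta> x < \<infinity>" "0 < r"
  shows "K_functional K1 n1 K2 n2 r x \<le> interp_norm K1 n1 K2 n2 \<theta> x * r powr \<theta>"
proof -
  have "ennreal (r powr (- \<theta>) * K_functional K1 n1 K2 n2 r x) \<le> interp_enorm K1 n1 K2 n2 \<theta> x"
    unfolding interp_enorm_def by (rule SUP_upper) (use assms in auto)
  then have "ennreal (r powr (- \<theta>) * K_functional K1 n1 K2 n2 r x)
      \<le> ennreal (interp_norm K1 n1 K2 n2 \<theta> x)"
    using assms(1) by (simp add: interp_norm_def)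
  then have "r powr (- \<theta>) * K_functional K1 n1 K2 n2 r x \<le> interp_norm K1 n1 K2 n2 \<theta> x"
    by (simp add: interp_norm_def)
  then show ?thesis
    using assms(2) by (simp add: powr_minus field_simps)
qed

lemma interp_enorm_leI:
  assumes "\<And>r. 0 < r \<Longrightarrow> K_functional K1 n1 K2 n2 r x \<le> C * r powr \<theta>"
  shows "interp_enorm K1 n1 K2 n2 \<theta> x \<le> ennreal C"
  unfolding interp_enorm_def
proof (intro SUP_least ennreal_leI)
  fix r :: real
  assume "r \<in> {0<..}"
  then show "r powr (- \<theta>) * K_functional K1 n1 K2 n2 r x \<le> C"
    using assms[of r] by (simp add: powr_minus field_simps)
qed

section \<open>Comparison of the norms\<close>

lemma zero_mem_Lip_b: "0 \<in> Lip_b R"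
  and lip_norm_zero: "lip_norm R 0 = 0"
proof -
  have "lip_seminorm R 0 \<le> ennreal 0"
    unfolding lip_seminorm_eq_hoelder_seminorm by (rule hoelder_seminorm_leI) auto
  then have *: "lip_seminorm R 0 = 0" by simp
  show "0 \<in> Lip_b R"
    using * by (simp add: Lip_b_def BUC_def uniformly_continuous_on_const)
  show "lip_norm R 0 = 0"
    using * by (simp add: lip_norm_def)
qed

lemma lip_norm_nonneg: "0 \<le> lip_norm R f"
  by (simp add: lip_norm_def)

lemma interp_enorm_le_hoelder_norm:
  fixes R :: "'h::real_normed_vector \<Rightarrow> 'h"
  assumes "linear R" "0 < \<alpha>" "\<alpha> < 1" "f \<in> BUC_hoelder R \<alpha>"
  shows "interp_enorm BUC norm (Lip_b R) (lip_norm R) \<alpha> f \<le> ennreal (2 * hoelder_norm R \<alpha> f)"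
proof (rule interp_enorm_leI)
  fix r :: real
  assume "0 < r"
  define M where "M = enn2real (hoelder_seminorm R \<alpha> f)"
  have "0 \<le> M" by (simp add: M_def)
  have f: "f \<in> BUC" using assms(4) by (simp add: BUC_hoelder_def)
  have "K_functional BUC norm (Lip_b R) (lip_norm R) r f \<le> (norm f + 2 * M) * r powr \<alpha>"
  proof (cases "r \<le> 1")
    case True
    obtain b where b: "b \<in> Lip_b R" "norm (f - b) \<le> M * r powr \<alpha>" "norm b \<le> norm f"
      "enn2real (lip_seminorm R b) \<le> M * r powr (\<alpha> - 1)"
      using hoelder_splitting[OF assms \<open>0 < r\<close>] unfolding M_def by blast
    have "f - b \<in> BUC"
      using f b(1) by (simp add: BUC_def Lip_b_def uniformly_continuous_on_diff)
    then have "K_functional BUC norm (Lip_b R) (lip_norm R) r f \<le> norm (f - b) + r * lip_norm R b"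
      using b(1) \<open>0 < r\<close> by (intro K_functional_le lip_norm_nonneg) auto
    also have "\<dots> \<le> M * r powr \<alpha> + r * (norm f + M * r powr (\<alpha> - 1))"
      using b \<open>0 < r\<close> by (intro add_mono mult_left_mono) (auto simp: lip_norm_def)
    also have "\<dots> = 2 * M * r powr \<alpha> + r powr 1 * norm f"
      using \<open>0 < r\<close> by (simp add: powr_diff algebra_simps)
    also have "\<dots> \<le> 2 * M * r powr \<alpha> + r powr \<alpha> * norm f"
      using \<open>0 < r\<close> True assms by (intro add_left_mono mult_right_mono powr_mono') auto
    finally show ?thesis by (simp add: algebra_simps)
  next
    case False
    have "K_functional BUC norm (Lip_b R) (lip_norm R) r f \<le> norm f + r * lip_norm R 0"
      using f \<open>0 < r\<close> by (intro K_functional_le zero_mem_Lip_b lip_norm_nonneg) auto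
    also have "\<dots> \<le> norm f + 2 * M"
      using \<open>0 \<le> M\<close> by (simp add: lip_norm_zero)
    also have "\<dots> \<le> (norm f + 2 * M) * r powr \<alpha>"
      using \<open>0 \<le> M\<close> False assms(2) ge_one_powr_ge_zero[of r \<alpha>]
        mult_left_mono[of 1 "r powr \<alpha>" "norm f + 2 * M"] by simp
    finally show ?thesis .
  qed
  also have "\<dots> \<le> 2 * hoelder_norm R \<alpha> f * r powr \<alpha>"
    by (intro mult_right_mono) (auto simp: hoelder_norm_def M_def)
  finally show "K_functional BUC norm (Lip_b R) (lip_norm R) r f
      \<le> 2 * hoelder_norm R \<alpha> f * r powr \<alpha>" .
qed

lemma increment_le_K_functional:
  fixes R :: "'h::real_normed_vector \<Rightarrow> 'h"
  assumes "linear R" "f \<in> BUC"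
  shows "\<bar>f (x + R v) - f x\<bar> \<le> 2 * K_functional BUC norm (Lip_b R) (lip_norm R) (norm v) f"
proof -
  have "\<bar>f (x + R v) - f x\<bar> / 2 \<le> K_functional BUC norm (Lip_b R) (lip_norm R) (norm v) f"
  proof (rule le_K_functionalI[OF assms(2) zero_mem_Lip_b])
    fix a b :: "'h \<Rightarrow>\<^sub>C real"
    assume ab: "f = a + b" "b \<in> Lip_b R"
    have "hoelder_seminorm R 1 b < \<infinity>"
      using ab(2) by (simp add: Lip_b_def lip_seminorm_eq_hoelder_seminorm)
    from hoelder_seminorm_increment_le[OF this assms(1), of x v]
    have "\<bar>b (x + R v) - b x\<bar> \<le> norm v * enn2real (lip_seminorm R b)"
      by (simp add: lip_seminorm_eq_hoelder_seminorm mult.commute)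
    also have "\<dots> \<le> norm v * lip_norm R b"
      by (intro mult_left_mono) (auto simp: lip_norm_def)
    finally have "\<bar>b (x + R v) - b x\<bar> \<le> norm v * lip_norm R b" .
    moreover have "0 \<le> norm v * lip_norm R b"
      by (simp add: lip_norm_nonneg)
    ultimately show "\<bar>f (x + R v) - f x\<bar> / 2 \<le> norm a + norm v * lip_norm R b"
      using norm_bounded[of a x] norm_bounded[of a "x + R v"] by (simp add: ab(1))
  qed
  then show ?thesis by simp
qed

lemma norm_le_K_functional_one:
  assumes "f \<in> BUC"
  shows "norm f \<le> K_functional BUC norm (Lip_b R) (lip_norm R) 1 f"
proof (rule le_K_functionalI[OF assms zero_mem_Lip_b])
  fix a b :: "'a \<Rightarrow>\<^sub>C real"
  assume "f = a + b"
  moreover have "norm b \<le> lip_norm R b"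
    by (simp add: lip_norm_def)
  ultimately show "norm f \<le> norm a + 1 * lip_norm R b"
    using norm_triangle_ineq[of a b] by simp
qed

lemma hoelder_bounds_of_interp_space:
  fixes R :: "'h::real_normed_vector \<Rightarrow> 'h"
  assumes "linear R" "f \<in> interp_space BUC norm (Lip_b R) (lip_norm R) \<alpha>"
  shows "f \<in> BUC_hoelder R \<alpha>"
    and "hoelder_norm R \<alpha> f \<le> 3 * interp_norm BUC norm (Lip_b R) (lip_norm R) \<alpha> f"
proof -
  define N where "N = interp_norm BUC norm (Lip_b R) (lip_norm R) \<alpha> f"
  have "0 \<le> N" by (simp add: N_def interp_norm_def)
  have f: "f \<in> BUC" "interp_enorm BUC norm (Lip_b R) (lip_norm R) \<alpha> f < \<infinity>"
    using assms(2) by (auto simp: interp_space_def)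
  have K: "K_functional BUC norm (Lip_b R) (lip_norm R) r f \<le> N * r powr \<alpha>" if "0 < r" for r
    using K_functional_le_interp_norm[OF f(2) that] by (simp add: N_def)
  have semi: "hoelder_seminorm R \<alpha> f \<le> ennreal (2 * N)"
  proof (rule hoelder_seminorm_leI)
    fix x v :: 'h
    assume "v \<noteq> 0"
    then show "\<bar>f (x + R v) - f x\<bar> \<le> 2 * N * norm v powr \<alpha>"
      using increment_le_K_functional[OF assms(1) f(1), of x v] K[of "norm v"] by simp
  qed
  then show "f \<in> BUC_hoelder R \<alpha>"
    using f(1) by (auto simp: BUC_hoelder_def intro: le_less_trans)
  have "enn2real (hoelder_seminorm R \<alpha> f) \<le> 2 * N"
    using enn2real_leI[OF _ semi] \<open>0 \<le> N\<close> by simp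
  moreover have "norm f \<le> N"
    using norm_le_K_functional_one[OF f(1), of R] K[of 1] by simp
  ultimately show "hoelder_norm R \<alpha> f \<le> 3 * interp_norm BUC norm (Lip_b R) (lip_norm R) \<alpha> f"
    by (simp add: hoelder_norm_def N_def)
qed

theorem theorem4p13:
  fixes R :: "'h::{real_inner, complete_space} \<Rightarrow> 'h" and \<alpha> :: real
  assumes "separable_space (euclidean :: 'h topology)"
    and "bounded_linear R"
    and "\<forall>x y. R x \<bullet> y = x \<bullet> R y"
    and "0 < \<alpha>" and "\<alpha> < 1"
  shows "BUC_hoelder R \<alpha> = interp_space BUC norm (Lip_b R) (lip_norm R) \<alpha> \<and>
    equivalent_norms_on (BUC_hoelder R \<alpha>)
      (hoelder_norm R \<alpha>) (interp_norm BUC norm (Lip_b R) (lip_norm R) \<alpha>)"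
proof
  have "linear R"
    using assms(2) by (rule bounded_linear.linear)
  note to_interp = interp_enorm_le_hoelder_norm[OF this assms(4,5)]
  note to_hoelder = hoelder_bounds_of_interp_space[OF \<open>linear R\<close>]
  have "f \<in> interp_space BUC norm (Lip_b R) (lip_norm R) \<alpha>" if "f \<in> BUC_hoelder R \<alpha>" for f
    using to_interp[OF that] that
    by (auto simp: interp_space_def BUC_hoelder_def intro: le_less_trans)
  then show eq: "BUC_hoelder R \<alpha> = interp_space BUC norm (Lip_b R) (lip_norm R) \<alpha>"
    using to_hoelder(1) by blast
  have "1 / 3 * hoelder_norm R \<alpha> f \<le> interp_norm BUC norm (Lip_b R) (lip_norm R) \<alpha> f"
    and "interp_norm BUC norm (Lip_b R) (lip_norm R) \<alpha> f \<le> 2 * hoelder_norm R \<alpha> f"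
    if "f \<in> BUC_hoelder R \<alpha>" for f
  proof -
    show "1 / 3 * hoelder_norm R \<alpha> f \<le> interp_norm BUC norm (Lip_b R) (lip_norm R) \<alpha> f"
      using to_hoelder(2)[of f \<alpha>] that eq by simp
    show "interp_norm BUC norm (Lip_b R) (lip_norm R) \<alpha> f \<le> 2 * hoelder_norm R \<alpha> f"
      unfolding interp_norm_def
      by (rule enn2real_leI[OF _ to_interp[OF that]]) (simp add: hoelder_norm_def)
  qed
  then show "equivalent_norms_on (BUC_hoelder R \<alpha>)
      (hoelder_norm R \<alpha>) (interp_norm BUC norm (Lip_b R) (lip_norm R) \<alpha>)"
    unfolding equivalent_norms_on_def
    by (intro exI[of _ "1 / 3"] exI[of _ 2] conjI ballI) simp_all
qed

end
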